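(* Let $X$ be a complex torus and let $\mathcal{L}$ be a holomorphic line bundle over $X$ with $\mathcal{L}\in\mathrm{Pic}^0(X)$. Then the group $\mathbf{S}(\mathcal{L})$ is commutative.
   Context: A complex torus is a connected compact complex Lie group $X=V/L$, where $V$ is a finite-dimensional complex vector space and $L\subset V$ a discrete subgroup of rank $2\dim_{\mathbb{C}}V$. For $x\in X$, $T_x:X\to X$, $z\mapsto z+x$. $\mathcal{L}\in\mathrm{Pic}^0(X)$ means that $\mathcal{L}$ is isomorphic to the quotient of $V\times\mathbb{C}$ by the action of $L$ given by $l:(v,c)\mapsto(v+l,\alpha(l)c)$ for some group homomorphism $\alpha:L\to\mathrm{U}(1)$ (equivalently, the Hermitian form attached to $\mathcal{L}$ by the Appell–Humbert theorem is zero). $\mathbf{S}(\mathcal{L})$ is the group (under composition) of all holomorphic automorphisms $\mathfrak{u}$ of the total space of $\mathcal{L}$ for which there is $x\in X$ such that $\mathfrak{u}$ is a lifting of $T_x$ (i.e. it covers $T_x$ with respect to the bundle projection) and for each $z\in X$ the induced map of fibers $\mathcal{L}_z\to\mathcal{L}_{z+x}$ is a $\mathbb{C}$-linear isomorphism. *)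

theory Defs
  imports "HOL-Analysis.Analysis" "HOL-Algebra.Bij"
begin

section \<open>Finite-dimensional complex vector spaces and holomorphic maps between them\<close>

text \<open>
  A finite-dimensional complex vector space is a type carrying a complex scalar multiplication.
  The type class only supplies a norm compatible with the underlying real structure; in finite
  dimension all norms are equivalent, so the choice does not affect any notion below.
  Dimension 0 is allowed.
\<close>

locale complex_fd_space = vector_space scale
  for scale :: "complex \<Rightarrow> 'v::real_normed_vector \<Rightarrow> 'v" +
  assumes scale_of_real: "scale (of_real r) v = r *\<^sub>R v"
    and finite_dim: "\<exists>B. finite B \<and> span B = UNIV"

text \<open>The scalar multiplication of \<open>V \<times> \<complex>\<close>.\<close>

definition prod_scale :: "(complex \<Rightarrow> 'v \<Rightarrow> 'v) \<Rightarrow> complex \<Rightarrow> 'v \<times> complex \<Rightarrow> 'v \<times> complex" where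
  "prod_scale s k p = (s k (fst p), k * snd p)"

text \<open>Holomorphic on an open set: Frechet differentiable with complex-linear derivative.\<close>

definition holo_on ::
  "(complex \<Rightarrow> 'm::real_normed_vector \<Rightarrow> 'm) \<Rightarrow> (complex \<Rightarrow> 'n::real_normed_vector \<Rightarrow> 'n)
    \<Rightarrow> ('m \<Rightarrow> 'n) \<Rightarrow> 'm set \<Rightarrow> bool" where
  "holo_on s t f U \<longleftrightarrow> open U \<and>
    (\<forall>z\<in>U. \<exists>D. (f has_derivative D) (at z) \<and> Vector_Spaces.linear s t D)"


section \<open>Complex manifolds\<close>

text \<open>An atlas consists of pairs of a chart domain and a coordinate map into the model space.\<close>

record ('a, 'm) cmanifold =
  mtop :: "'a topology"
  charts :: "('a set \<times> ('a \<Rightarrow> 'm)) set"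

abbreviation points :: "('a, 'm, 'z) cmanifold_scheme \<Rightarrow> 'a set" where
  "points M \<equiv> topspace (mtop M)"

definition complex_manifold ::
  "(complex \<Rightarrow> 'm::real_normed_vector \<Rightarrow> 'm) \<Rightarrow> ('a, 'm, 'z) cmanifold_scheme \<Rightarrow> bool" where
  "complex_manifold s M \<longleftrightarrow>
    Hausdorff_space (mtop M) \<and> second_countable (mtop M) \<and>
    (\<Union>(C, \<phi>)\<in>charts M. C) = points M \<and>
    (\<forall>(C, \<phi>)\<in>charts M. openin (mtop M) C \<and> open (\<phi> ` C) \<and>
       homeomorphic_map (subtopology (mtop M) C) (top_of_set (\<phi> ` C)) \<phi>) \<and>
    (\<forall>(C, \<phi>)\<in>charts M. \<forall>(D, \<psi>)\<in>charts M.
       holo_on s s (\<lambda>w. \<psi> (inv_into C \<phi> w)) (\<phi> ` (C \<inter> D)))"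

definition holomorphic_map ::
  "(complex \<Rightarrow> 'm::real_normed_vector \<Rightarrow> 'm) \<Rightarrow> (complex \<Rightarrow> 'n::real_normed_vector \<Rightarrow> 'n)
    \<Rightarrow> ('a, 'm, 'y) cmanifold_scheme \<Rightarrow> ('b, 'n, 'z) cmanifold_scheme \<Rightarrow> ('a \<Rightarrow> 'b) \<Rightarrow> bool" where
  "holomorphic_map s t M N f \<longleftrightarrow>
    continuous_map (mtop M) (mtop N) f \<and>
    (\<forall>(C, \<phi>)\<in>charts M. \<forall>(D, \<psi>)\<in>charts N.
       holo_on s t (\<lambda>w. \<psi> (f (inv_into C \<phi> w))) (\<phi> ` {x \<in> C. f x \<in> D}))"

definition biholomorphic_map ::
  "(complex \<Rightarrow> 'm::real_normed_vector \<Rightarrow> 'm) \<Rightarrow> (complex \<Rightarrow> 'n::real_normed_vector \<Rightarrow> 'n)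
    \<Rightarrow> ('a, 'm, 'y) cmanifold_scheme \<Rightarrow> ('b, 'n, 'z) cmanifold_scheme \<Rightarrow> ('a \<Rightarrow> 'b) \<Rightarrow> bool" where
  "biholomorphic_map s t M N f \<longleftrightarrow>
    bij_betw f (points M) (points N) \<and>
    holomorphic_map s t M N f \<and> holomorphic_map t s N M (inv_into (points M) f)"

text \<open>The open submanifold with underlying set \<open>U\<close>; further record fields are kept.\<close>

definition restrict_open :: "('a, 'm, 'z) cmanifold_scheme \<Rightarrow> 'a set \<Rightarrow> ('a, 'm, 'z) cmanifold_scheme" where
  "restrict_open M U =
    M\<lparr>mtop := subtopology (mtop M) U, charts := {(C \<inter> U, \<phi>) | C \<phi>. (C, \<phi>) \<in> charts M}\<rparr>"


section \<open>Holomorphic line bundles\<close>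

text \<open>
  A line bundle is given by the complex manifold structure of its total space, the projection, and
  the addition and scalar multiplication of the fibres. If the base is modelled on \<open>V\<close> then the
  total space is modelled on \<open>V \<times> \<complex>\<close>.
\<close>

record ('e, 'm, 'x) line_bundle = "('e, 'm) cmanifold" +
  proj :: "'e \<Rightarrow> 'x"
  fadd :: "'e \<Rightarrow> 'e \<Rightarrow> 'e"
  fscale :: "complex \<Rightarrow> 'e \<Rightarrow> 'e"

definition fibre :: "('e, 'm, 'x) line_bundle \<Rightarrow> 'x \<Rightarrow> 'e set" where
  "fibre E z = {e \<in> points E. proj E e = z}"

definition fibre_linear ::
  "('e, 'm, 'x) line_bundle \<Rightarrow> ('f, 'n, 'x) line_bundle \<Rightarrow> ('e \<Rightarrow> 'f) \<Rightarrow> 'x \<Rightarrow> 'x \<Rightarrow> bool" where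
  "fibre_linear E F f z z' \<longleftrightarrow>
    f \<in> fibre E z \<rightarrow> fibre F z' \<and>
    (\<forall>a\<in>fibre E z. \<forall>b\<in>fibre E z. f (fadd E a b) = fadd F (f a) (f b)) \<and>
    (\<forall>k. \<forall>a\<in>fibre E z. f (fscale E k a) = fscale F k (f a))"

text \<open>Isomorphism of line bundles over the same base (covering the identity).\<close>

definition bundle_iso ::
  "(complex \<Rightarrow> 'v::real_normed_vector \<Rightarrow> 'v) \<Rightarrow> ('e, 'v \<times> complex, 'x) line_bundle
    \<Rightarrow> ('f, 'v \<times> complex, 'x) line_bundle \<Rightarrow> ('e \<Rightarrow> 'f) \<Rightarrow> bool" where
  "bundle_iso s E F f \<longleftrightarrow>
    biholomorphic_map (prod_scale s) (prod_scale s) E F f \<and>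
    (\<forall>e\<in>points E. proj F (f e) = proj E e) \<and>
    (\<forall>z. fibre_linear E F f z z)"

definition trivial_bundle ::
  "('x, 'v, 'z) cmanifold_scheme \<Rightarrow> ('x \<times> complex, 'v \<times> complex, 'x) line_bundle" where
  "trivial_bundle X =
    \<lparr>mtop = prod_topology (mtop X) euclidean,
     charts = {(C \<times> UNIV, map_prod \<phi> id) | C \<phi>. (C, \<phi>) \<in> charts X},
     proj = fst,
     fadd = (\<lambda>a b. (fst a, snd a + snd b)),
     fscale = (\<lambda>k a. (fst a, k * snd a))\<rparr>"

text \<open>
  The local trivializations are bijective and linear on fibres, so together with closure they make
  each fibre a one-dimensional complex vector space, and they make the projection surjective.
\<close>

definition holomorphic_line_bundle ::
  "(complex \<Rightarrow> 'v::real_normed_vector \<Rightarrow> 'v) \<Rightarrow> ('x, 'v, 'z) cmanifold_scheme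
    \<Rightarrow> ('e, 'v \<times> complex, 'x) line_bundle \<Rightarrow> bool" where
  "holomorphic_line_bundle s X E \<longleftrightarrow>
    complex_manifold (prod_scale s) E \<and>
    holomorphic_map (prod_scale s) s E X (proj E) \<and>
    (\<forall>z\<in>points X. (\<forall>a\<in>fibre E z. \<forall>b\<in>fibre E z. fadd E a b \<in> fibre E z) \<and>
                  (\<forall>k. \<forall>a\<in>fibre E z. fscale E k a \<in> fibre E z)) \<and>
    (\<forall>x\<in>points X. \<exists>U f. openin (mtop X) U \<and> x \<in> U \<and>
       bundle_iso s (restrict_open E {e \<in> points E. proj E e \<in> U})
                    (trivial_bundle (restrict_open X U)) f)"


section \<open>Complex tori and the bundles in Pic0\<close>

text \<open>The rank of a subgroup: the maximal number of \<open>\<int>\<close>-linearly independent elements.\<close>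

definition has_rank :: "'v::real_vector set \<Rightarrow> nat \<Rightarrow> bool" where
  "has_rank L r \<longleftrightarrow>
    (let indep = (\<lambda>B. \<not> module.dependent (\<lambda>(k::int) v. real_of_int k *\<^sub>R v) B) in
     (\<exists>B\<subseteq>L. finite B \<and> card B = r \<and> indep B) \<and>
     (\<forall>B\<subseteq>L. indep B \<longrightarrow> finite B \<and> card B \<le> r))"

definition torus_lattice :: "(complex \<Rightarrow> 'v::real_normed_vector \<Rightarrow> 'v) \<Rightarrow> 'v set \<Rightarrow> bool" where
  "torus_lattice s L \<longleftrightarrow>
    0 \<in> L \<and> (\<forall>l\<in>L. \<forall>m\<in>L. l - m \<in> L) \<and> discrete L \<and>
    has_rank L (2 * vector_space.dim s UNIV)"

text \<open>
  For a quotient map \<open>q\<close> by a free, properly discontinuous action on a vector space: the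
  quotient topology, with the local inverses of \<open>q\<close> as charts.
\<close>

definition quotient_topology :: "('m::topological_space \<Rightarrow> 'a) \<Rightarrow> 'a topology" where
  "quotient_topology q = topology (\<lambda>U. U \<subseteq> range q \<and> open (q -` U))"

definition quotient_charts ::
  "('m::topological_space \<Rightarrow> 'a) \<Rightarrow> ('a set \<times> ('a \<Rightarrow> 'm)) set" where
  "quotient_charts q = {(q ` W, inv_into W q) | W. open W \<and> inj_on q W}"

text \<open>The points of \<open>V/L\<close> are the cosets \<open>v +o L\<close>; the group operation is addition of sets.\<close>

definition torus :: "'v::real_normed_vector set \<Rightarrow> ('v set, 'v) cmanifold" where
  "torus L = \<lparr>mtop = quotient_topology (\<lambda>v. v +o L), charts = quotient_charts (\<lambda>v. v +o L)\<rparr>"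

definition translation :: "'v::real_normed_vector set \<Rightarrow> 'v set \<Rightarrow> 'v set" where
  "translation x z = z + x"

definition unitary_character :: "'v::real_normed_vector set \<Rightarrow> ('v \<Rightarrow> complex) \<Rightarrow> bool" where
  "unitary_character L \<alpha> \<longleftrightarrow>
    (\<forall>l\<in>L. norm (\<alpha> l) = 1) \<and> (\<forall>l\<in>L. \<forall>m\<in>L. \<alpha> (l + m) = \<alpha> l * \<alpha> m)"

definition flat_orbit ::
  "'v::real_normed_vector set \<Rightarrow> ('v \<Rightarrow> complex) \<Rightarrow> 'v \<times> complex \<Rightarrow> ('v \<times> complex) set" where
  "flat_orbit L \<alpha> p = {(fst p + l, \<alpha> l * snd p) | l. l \<in> L}"

text \<open>
  The quotient of \<open>V \<times> \<complex>\<close> by \<open>L\<close> acting through \<open>\<alpha>\<close>. Its elements are orbits; the first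
  components of an orbit form the coset it lies over, and orbits over the same coset are added
  through representatives with equal first component.
\<close>

definition flat_bundle ::
  "'v::real_normed_vector set \<Rightarrow> ('v \<Rightarrow> complex)
    \<Rightarrow> (('v \<times> complex) set, 'v \<times> complex, 'v set) line_bundle" where
  "flat_bundle L \<alpha> =
    \<lparr>mtop = quotient_topology (flat_orbit L \<alpha>),
     charts = quotient_charts (flat_orbit L \<alpha>),
     proj = (\<lambda>S. fst ` S),
     fadd = (\<lambda>S T. {(v, c + d) | v c d. (v, c) \<in> S \<and> (v, d) \<in> T}),
     fscale = (\<lambda>k S. {(v, k * c) | v c. (v, c) \<in> S})\<rparr>"

definition in_Pic0 ::
  "(complex \<Rightarrow> 'v::real_normed_vector \<Rightarrow> 'v) \<Rightarrow> 'v set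
    \<Rightarrow> ('e, 'v \<times> complex, 'v set) line_bundle \<Rightarrow> bool" where
  "in_Pic0 s L E \<longleftrightarrow> (\<exists>\<alpha> f. unitary_character L \<alpha> \<and> bundle_iso s E (flat_bundle L \<alpha>) f)"


section \<open>The group of automorphisms lifting translations\<close>

text \<open>
  Automorphisms of the total space are represented by functions that are \<open>undefined\<close> outside it,
  as in \<^const>\<open>BijGroup\<close>, whose composition is used.
\<close>

definition translation_lifts ::
  "(complex \<Rightarrow> 'v::real_normed_vector \<Rightarrow> 'v) \<Rightarrow> 'v set
    \<Rightarrow> ('e, 'v \<times> complex, 'v set) line_bundle \<Rightarrow> ('e \<Rightarrow> 'e) set" where
  "translation_lifts s L E =
    {u \<in> extensional (points E).
       biholomorphic_map (prod_scale s) (prod_scale s) E E u \<and>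
       (\<exists>x\<in>points (torus L).
          (\<forall>e\<in>points E. proj E (u e) = translation x (proj E e)) \<and>
          (\<forall>z\<in>points (torus L).
             bij_betw u (fibre E z) (fibre E (translation x z)) \<and>
             fibre_linear E E u z (translation x z)))}"

definition S_group ::
  "(complex \<Rightarrow> 'v::real_normed_vector \<Rightarrow> 'v) \<Rightarrow> 'v set
    \<Rightarrow> ('e, 'v \<times> complex, 'v set) line_bundle \<Rightarrow> ('e \<Rightarrow> 'e) monoid" where
  "S_group s L E = (BijGroup (points E))\<lparr>carrier := translation_lifts s L E\<rparr>"

end

theory Submission
  imports Defs "HOL-Complex_Analysis.Cauchy_Integral_Formula"
begin

text \<open>
  Through the isomorphism with a flat bundle, a lift of the translation by \<open>x + L\<close> becomes a map
  \<open>[v, d] \<mapsto> [v + x, g v * d]\<close>. Since the same character acts on source and target, \<open>g\<close> is an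
  \<open>L\<close>-periodic holomorphic function on \<open>V\<close>, hence bounded, hence constant by Liouville's theorem
  applied along complex lines. Maps of the form \<open>[v, d] \<mapsto> [v + x, c * d]\<close> commute.

  Boundedness needs that \<open>L\<close> is cocompact: if \<open>B \<subseteq> L\<close> is a real basis of the real span of \<open>L\<close>,
  then discreteness puts \<open>L\<close> into the rational span of \<open>B\<close>, so the rank of \<open>L\<close> is at most
  \<open>card B\<close>, and \<open>B\<close> spans \<open>V\<close>.
\<close>

section \<open>Discrete subgroups of full rank\<close>

lemma discrete_subgroup_separated:
  fixes L :: "'v::real_normed_vector set"
  assumes "0 \<in> L" and "discrete L"
  obtains \<epsilon> where "\<epsilon> > 0" and "\<And>l. l \<in> L \<Longrightarrow> norm l < \<epsilon> \<Longrightarrow> l = 0"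
proof -
  have "0 isolated_in L"
    using assms by (simp add: discrete_def)
  then show ?thesis
    using that by (auto simp: isolated_in_dist_Ex_iff)
qed

text \<open>Differences of elements of \<open>L\<close> lie in \<open>L\<close>, so isolation of 0
  with radius \<epsilon> keeps any two distinct elements at least \<epsilon> apart. A ball of radius
  \<epsilon>/2 therefore holds at most one of them, and finitely many such balls cover
  \<open>K\<close>.\<close>

lemma finite_discrete_subgroup_Int_compact:
  fixes L :: "'v::real_normed_vector set"
  assumes "0 \<in> L" and diff: "\<forall>l\<in>L. \<forall>m\<in>L. l - m \<in> L"
    and "discrete L" and "compact K"
  shows "finite (L \<inter> K)"
proof -
  obtain \<epsilon> where "\<epsilon> > 0" and \<epsilon>: "\<And>l. l \<in> L \<Longrightarrow> norm l < \<epsilon> \<Longrightarrow> l = 0"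
    using discrete_subgroup_separated assms by blast
  obtain k where k: "finite k" "K \<subseteq> (\<Union>x\<in>k. ball x (\<epsilon> / 2))"
    using compactE_image[OF \<open>compact K\<close>, of K "\<lambda>x. ball x (\<epsilon> / 2)"] \<open>\<epsilon> > 0\<close>
    by (metis centre_in_ball half_gt_zero_iff open_ball UN_I subsetI)
  have "finite (L \<inter> ball x (\<epsilon> / 2))" for x
  proof -
    have "a = b" if "a \<in> L \<inter> ball x (\<epsilon> / 2)" "b \<in> L \<inter> ball x (\<epsilon> / 2)" for a b
    proof -
      have "dist a b < \<epsilon>"
        using that dist_triangle_half_r[of x a \<epsilon> b] by auto
      then show ?thesis
        using \<epsilon>[of "a - b"] diff that by (auto simp: dist_norm)
    qed
    then show ?thesis
      by (metis finite.simps finite_subset insertCI subsetI)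
  qed
  then have "finite (\<Union>x\<in>k. L \<inter> ball x (\<epsilon> / 2))"
    using k by blast
  then show ?thesis
    by (rule rev_finite_subset) (use k in auto)
qed

text \<open>The coefficients run over a closed interval, which gives compactness. The overlap of
  translates along faces is harmless, because the set only has to catch the fractional part of every
  vector in the span of \<open>B\<close>.\<close>

definition parallelepiped :: "'v::real_normed_vector set \<Rightarrow> 'v set" where
  "parallelepiped B = {\<Sum>b\<in>B. t b *\<^sub>R b | t. \<forall>b\<in>B. t b \<in> {0..1}}"

text \<open>Adding a vector \<open>b\<close> replaces the set by its Minkowski sum with the segment
  from 0 to \<open>b\<close>, and a sum of compact sets is compact.\<close>

lemma compact_parallelepiped:
  assumes "finite B"
  shows "compact (parallelepiped B)"
  using assms
proof (induction B)
  case empty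
  then show ?case by (simp add: parallelepiped_def)
next
  case (insert b B)
  have "parallelepiped (insert b B) = {x + y | x y. x \<in> (\<lambda>r. r *\<^sub>R b) ` {0..1} \<and> y \<in> parallelepiped B}"
    (is "_ = ?S")
  proof
    show "parallelepiped (insert b B) \<subseteq> ?S"
      using insert.hyps by (fastforce simp: parallelepiped_def)
    show "?S \<subseteq> parallelepiped (insert b B)"
    proof
      fix z assume "z \<in> ?S"
      then obtain r t where z: "z = r *\<^sub>R b + (\<Sum>b\<in>B. t b *\<^sub>R b)" "r \<in> {0..1}" "\<forall>b\<in>B. t b \<in> {0..1}"
        by (auto simp: parallelepiped_def)
      have "(\<Sum>b\<in>B. t b *\<^sub>R b) = (\<Sum>c\<in>B. (t(b := r)) c *\<^sub>R c)"
        using insert.hyps by (intro sum.cong) auto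
      then have "z = (\<Sum>c\<in>insert b B. (t(b := r)) c *\<^sub>R c)"
        using z insert.hyps by simp
      moreover have "\<forall>c\<in>insert b B. (t(b := r)) c \<in> {0..1}"
        using z by simp
      ultimately show "z \<in> parallelepiped (insert b B)"
        unfolding parallelepiped_def by blast
    qed
  qed
  moreover have "compact ((\<lambda>r. r *\<^sub>R b) ` {0..1::real})"
    by (intro compact_continuous_image continuous_intros compact_Icc)
  ultimately show ?case
    using insert.IH compact_sums by force
qed

lemma additive_subgroup_sum_int:
  fixes L :: "'v::real_vector set"
  assumes "0 \<in> L" and diff: "\<forall>l\<in>L. \<forall>m\<in>L. l - m \<in> L"
    and "finite B" and "B \<subseteq> L"
  shows "(\<Sum>b\<in>B. real_of_int (k b) *\<^sub>R b) \<in> L"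
proof -
  have add: "l + m \<in> L" if "l \<in> L" "m \<in> L" for l m
  proof -
    have "l - (0 - m) \<in> L"
      using diff \<open>0 \<in> L\<close> that by blast
    then show ?thesis by simp
  qed
  have nat_mult: "real n *\<^sub>R l \<in> L" if "l \<in> L" for n l
    by (induction n) (use that \<open>0 \<in> L\<close> add in \<open>auto simp: scaleR_left_distrib\<close>)
  have int_mult: "real_of_int j *\<^sub>R l \<in> L" if "l \<in> L" for j l
    using nat_mult[OF that, of "nat j"] diff[rule_format, OF \<open>0 \<in> L\<close> nat_mult[OF that, of "nat (- j)"]]
    by (cases "j \<ge> 0") auto
  show ?thesis
    using \<open>finite B\<close> \<open>B \<subseteq> L\<close> by (induction B) (auto simp: \<open>0 \<in> L\<close> intro: add int_mult)
qed

section \<open>Independence over the integers and over the rationals\<close>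

interpretation rat_space: vector_space "\<lambda>(q::rat) v::'v::real_vector. of_rat q *\<^sub>R v"
  by unfold_locales (simp_all add: of_rat_add of_rat_mult scaleR_add_left scaleR_add_right)

interpretation int_module: module "\<lambda>(k::int) v::'v::real_vector. real_of_int k *\<^sub>R v"
  by unfold_locales (simp_all add: scaleR_add_left scaleR_add_right)

lemma common_denominator:
  fixes u :: "'a \<Rightarrow> rat"
  assumes "finite T"
  obtains d :: int and k where "d \<noteq> 0" and "\<And>v. v \<in> T \<Longrightarrow> of_int d * u v = of_int (k v)"
proof -
  have "\<exists>d::int. d \<noteq> 0 \<and> (\<forall>v\<in>T. \<exists>k::int. of_int d * u v = of_int k)"
    using assms
  proof (induction T)
    case empty
    then show ?case by (intro exI[of _ 1]) auto
  next
    case (insert v T)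
    then obtain d :: int where d: "d \<noteq> 0" "\<forall>v\<in>T. \<exists>k::int. of_int d * u v = of_int k"
      by blast
    obtain a b :: int where ab: "u v = of_int a / of_int b" "b > 0"
      by (metis quotient_of_denom_pos quotient_of_div surj_pair)
    have "\<exists>k::int. of_int (b * d) * u w = of_int k" if "w \<in> insert v T" for w
    proof (cases "w = v")
      case True
      then show ?thesis
        using ab by (intro exI[of _ "a * d"]) (simp add: field_simps)
    next
      case False
      then obtain k :: int where "of_int d * u w = of_int k"
        using d \<open>w \<in> insert v T\<close> by auto
      then show ?thesis
        by (intro exI[of _ "b * k"]) (simp add: mult.assoc)
    qed
    then show ?case
      using d ab by (intro exI[of _ "b * d"]) auto
  qed
  then show ?thesis
    using that by metis
qed

text \<open>A rational relation times a common denominator is an integer relation, still nontrivial.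
  The passage is needed because \<open>has_rank\<close> counts integer-independent elements, whereas
  the exchange argument that compares cardinalities works over a field.\<close>

lemma rat_independent_if_int_independent:
  assumes "int_module.independent C"
  shows "rat_space.independent C"
proof
  assume "rat_space.dependent C"
  then obtain T u where T: "finite T" "T \<subseteq> C" "(\<Sum>v\<in>T. of_rat (u v) *\<^sub>R v) = 0"
      "\<exists>v\<in>T. u v \<noteq> 0"
    unfolding rat_space.dependent_explicit by blast
  obtain d k where dk: "d \<noteq> 0" "\<And>v. v \<in> T \<Longrightarrow> of_int d * u v = of_int (k v)"
    using common_denominator[OF T(1), of u] by blast
  have k: "real_of_int (k v) = real_of_int d * of_rat (u v)" if "v \<in> T" for v
    using arg_cong[OF dk(2)[OF that], of "of_rat :: rat \<Rightarrow> real"] by (simp add: of_rat_mult)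
  have "(\<Sum>v\<in>T. real_of_int (k v) *\<^sub>R v) = real_of_int d *\<^sub>R (\<Sum>v\<in>T. of_rat (u v) *\<^sub>R v)"
    by (simp add: scaleR_sum_right k)
  moreover have "\<exists>v\<in>T. k v \<noteq> 0"
    using T(4) dk by force
  ultimately have "int_module.dependent C"
    using T unfolding int_module.dependent_explicit by auto
  then show False
    using assms by blast
qed

text \<open>
  The fractional parts of the multiples of a lattice vector all lie in the finite set
  \<^term>\<open>L \<inter> parallelepiped B\<close>, so two of them coincide.
\<close>

lemma discrete_subgroup_subset_rat_span:
  fixes L :: "'v::real_normed_vector set"
  assumes L: "0 \<in> L" "\<forall>l\<in>L. \<forall>m\<in>L. l - m \<in> L" "discrete L"
    and B: "finite B" "B \<subseteq> L" "L \<subseteq> span B"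
  shows "L \<subseteq> rat_space.span B"
proof
  fix l assume l: "l \<in> L"
  then obtain r where r: "l = (\<Sum>b\<in>B. r b *\<^sub>R b)"
    using B span_finite[of B] by auto
  define w where "w j = (\<Sum>b\<in>B. real_of_int \<lfloor>real j * r b\<rfloor> *\<^sub>R b)" for j :: nat
  define h where "h j = real j *\<^sub>R l - w j" for j :: nat
  have "h j \<in> L \<inter> parallelepiped B" for j
  proof
    have "real j *\<^sub>R l \<in> L"
      using additive_subgroup_sum_int[OF L(1,2), of "{l}" "\<lambda>_. int j"] l by simp
    then show "h j \<in> L"
      unfolding h_def w_def using L B additive_subgroup_sum_int[OF L(1,2)] by simp
    have "h j = (\<Sum>b\<in>B. frac (real j * r b) *\<^sub>R b)"
      by (simp add: h_def w_def r scaleR_sum_right frac_def scaleR_left_diff_distrib sum_subtractf)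
    then show "h j \<in> parallelepiped B"
      unfolding parallelepiped_def
      by (auto intro!: exI[of _ "\<lambda>b. frac (real j * r b)"] simp: less_imp_le[OF frac_lt_1])
  qed
  then have "range h \<subseteq> L \<inter> parallelepiped B"
    by blast
  then have "finite (range h)"
    using finite_discrete_subgroup_Int_compact[OF L compact_parallelepiped[OF B(1)]]
    by (rule finite_subset)
  then have "\<not> inj h"
    using finite_imageD infinite_UNIV_nat by blast
  then obtain i j where "h i = h j" "i \<noteq> j"
    by (auto simp: inj_on_def)
  then obtain i j where ij: "h i = h j" "i < j"
    by (metis linorder_neqE_nat)
  define n :: rat where "n = of_nat (j - i)"
  have "n \<noteq> 0" and n: "of_rat n = real j - real i"
    using ij by (simp_all add: n_def del: of_nat_diff)
  \<comment> \<open>Equal remainders make \<open>j - i\<close> times \<open>l\<close> an integer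
    combination of \<open>B\<close>; dividing by the nonzero \<open>n\<close> leaves a rational
    combination.\<close>
  have "of_rat n *\<^sub>R l = w j - w i"
    using ij by (simp add: h_def n scaleR_left_diff_distrib algebra_simps)
  also have "\<dots> = (\<Sum>b\<in>B. of_rat (of_int (\<lfloor>real j * r b\<rfloor> - \<lfloor>real i * r b\<rfloor>)) *\<^sub>R b)"
    by (simp add: w_def sum_subtractf scaleR_left_diff_distrib of_rat_diff)
  also have "\<dots> \<in> rat_space.span B"
    by (intro rat_space.span_sum rat_space.span_scale rat_space.span_base)
  finally have "of_rat (1 / n) *\<^sub>R (of_rat n *\<^sub>R l) \<in> rat_space.span B"
    by (rule rat_space.span_scale)
  then show "l \<in> rat_space.span B"
    using \<open>n \<noteq> 0\<close> by (simp add: of_rat_divide)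
qed

text \<open>\<open>T\<close> is a real generating set and \<open>C\<close> witnesses the rank.
  Independence of \<open>C\<close> in the rational span of \<open>B\<close> gives
  \<open>card C \<le> card B\<close>; a vector outside the real span of \<open>B\<close> would
  extend \<open>B\<close> to an independent set with more elements than \<open>T\<close>. So
  \<open>B\<close> spans, and every vector can be reduced modulo its integer combinations.\<close>

lemma discrete_subgroup_cocompact:
  fixes L C T :: "'v::real_normed_vector set"
  assumes L: "0 \<in> L" "\<forall>l\<in>L. \<forall>m\<in>L. l - m \<in> L" "discrete L"
    and C: "C \<subseteq> L" "int_module.independent C"
    and T: "finite T" "span T = UNIV" "card T \<le> card C"
  obtains K where "compact K" and "\<And>v. \<exists>l\<in>L. v + l \<in> K"
proof -
  obtain B where B: "B \<subseteq> L" "independent B" "L \<subseteq> span B"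
    by (rule real_vector.basis_exists[of L])
  have "finite B"
    using independent_span_bound[OF T(1) B(2)] T by auto
  have "C \<subseteq> rat_space.span B"
    using discrete_subgroup_subset_rat_span[OF L \<open>finite B\<close> B(1,3)] C by blast
  then have "card C \<le> card B"
    using rat_space.independent_span_bound[OF \<open>finite B\<close> rat_independent_if_int_independent[OF C(2)]]
    by blast
  have spanB: "v \<in> span B" for v
  proof (rule ccontr)
    assume v: "v \<notin> span B"
    then have "card (insert v B) \<le> card T"
      using independent_span_bound[OF T(1), of "insert v B"]
        independent_insertI[OF v B(2)] T by auto
    moreover have "v \<notin> B"
      using v span_base by blast
    ultimately show False
      using \<open>finite B\<close> \<open>card C \<le> card B\<close> C T by simp
  qed
  have "\<exists>l\<in>L. v + l \<in> parallelepiped B" for v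
  proof -
    obtain r where r: "v = (\<Sum>b\<in>B. r b *\<^sub>R b)"
      using spanB[of v] span_finite[OF \<open>finite B\<close>] by auto
    \<comment> \<open>Removing the integer parts of the coordinates means adding an element of
      \<open>L\<close>, since \<open>B \<subseteq> L\<close>.\<close>
    let ?l = "\<Sum>b\<in>B. real_of_int (- \<lfloor>r b\<rfloor>) *\<^sub>R b"
    have "v + ?l = (\<Sum>b\<in>B. frac (r b) *\<^sub>R b)"
      by (simp add: r frac_def scaleR_left_diff_distrib sum_subtractf sum_negf)
    then have "v + ?l \<in> parallelepiped B"
      unfolding parallelepiped_def
      by (auto intro!: exI[of _ "\<lambda>b. frac (r b)"] simp: less_imp_le[OF frac_lt_1])
    then show ?thesis
      by (rule bexI[of _ ?l]) (rule additive_subgroup_sum_int[OF L(1,2) \<open>finite B\<close> B(1)])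
  qed
  then show ?thesis
    by (rule that[OF compact_parallelepiped[OF \<open>finite B\<close>]])
qed

section \<open>Periodic holomorphic functions on a complex vector space\<close>

context complex_fd_space
begin

text \<open>The locale assumes no continuity of \<open>scale\<close>, only its agreement with real
  scaling. This real form yields both a real generating set and the derivative of
  \<open>scale z v\<close> in \<open>z\<close>.\<close>

lemma scale_split: "scale z v = Re z *\<^sub>R v + Im z *\<^sub>R scale \<i> v"
proof -
  have "scale z v = scale (of_real (Re z) + of_real (Im z) * \<i>) v"
    by (simp add: complex_eq mult.commute)
  also have "\<dots> = scale (of_real (Re z)) v + scale (of_real (Im z)) (scale \<i> v)"
    by (simp only: scale_left_distrib scale_scale)
  finally show ?thesis
    by (simp only: scale_of_real)
qed

text \<open>A complex basis together with its multiples by \<i> generates over the reals. The upper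
  bound on its size is what the comparison with the rank \<open>2 * dim UNIV\<close> of the lattice
  calls for.\<close>

lemma real_generators:
  obtains T :: "'v set" where "finite T" and "card T \<le> 2 * dim UNIV" and "Real_Vector_Spaces.span T = UNIV"
proof -
  obtain B0 where "finite B0" "span B0 = UNIV"
    using finite_dim by blast
  obtain B where B: "independent B" "span B = UNIV" "card B = dim UNIV"
    using basis_exists[of UNIV] by (metis top.extremum_unique)
  have "finite B"
    using independent_span_bound[OF \<open>finite B0\<close> B(1)] \<open>span B0 = UNIV\<close> by auto
  let ?T = "B \<union> scale \<i> ` B"
  have "card ?T \<le> 2 * dim UNIV"
    using card_Un_le[of B "scale \<i> ` B"] card_image_le[OF \<open>finite B\<close>, of "scale \<i>"] B by linarith
  moreover have "v \<in> Real_Vector_Spaces.span ?T" for v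
  proof -
    obtain c where c: "v = (\<Sum>b\<in>B. scale (c b) b)"
      using B span_finite[OF \<open>finite B\<close>] by blast
    show ?thesis
      unfolding c scale_split[of "c _"]
      by (intro real_vector.span_sum real_vector.span_add real_vector.span_scale
          real_vector.span_base) auto
  qed
  ultimately show ?thesis
    using that[of ?T] \<open>finite B\<close> by auto
qed

lemma torus_lattice_cocompact:
  assumes "torus_lattice scale L"
  obtains K where "compact K" and "\<And>v. \<exists>l\<in>L. v + l \<in> K"
proof -
  have L: "0 \<in> L" "\<forall>l\<in>L. \<forall>m\<in>L. l - m \<in> L" "discrete L"
    and "has_rank L (2 * dim UNIV)"
    using assms by (auto simp: torus_lattice_def)
  then obtain C where C: "C \<subseteq> L" "card C = 2 * dim UNIV" "int_module.independent C"
    by (auto simp: has_rank_def Let_def)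
  obtain T :: "'v set" where "finite T" "card T \<le> 2 * dim UNIV" "Real_Vector_Spaces.span T = UNIV"
    using real_generators .
  then show ?thesis
    using discrete_subgroup_cocompact[OF L C(1,3), of T] C(2) that by metis
qed

lemma periodic_holomorphic_constant:
  assumes L: "torus_lattice scale L"
    and g: "holo_on scale (*) g UNIV"
    and per: "\<And>v l. l \<in> L \<Longrightarrow> g (v + l) = g v"
  shows "g v = (g 0 :: complex)"
proof -
  obtain K where K: "compact K" "\<And>v. \<exists>l\<in>L. v + l \<in> K"
    using torus_lattice_cocompact[OF L] by metis
  have deriv: "\<exists>D. (g has_derivative D) (at w) \<and> Vector_Spaces.linear scale (*) D" for w
    using g by (simp add: holo_on_def)
  then have "isCont g w" for w
    using has_derivative_continuous by blast
  then have "continuous_on UNIV g"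
    by (simp add: continuous_at_imp_continuous_on)
  then have "bounded (g ` K)"
    by (meson K(1) compact_continuous_image compact_imp_bounded continuous_on_subset subset_UNIV)
  \<comment> \<open>By periodicity every value of \<open>g\<close> is already attained on the
    compact set \<open>K\<close>.\<close>
  moreover have "range g \<subseteq> g ` K"
  proof
    fix y assume "y \<in> range g"
    then obtain v where "y = g v"
      by blast
    moreover obtain l where "l \<in> L" "v + l \<in> K"
      using K(2) by blast
    ultimately show "y \<in> g ` K"
      using per[of l v] by (metis image_eqI)
  qed
  ultimately have "bounded (range g)"
    using bounded_subset by blast
  \<comment> \<open>The restriction to the complex line through 0 and \<open>v\<close> brings
    Liouville's theorem down to one variable; its values at 0 and 1 are \<open>g 0\<close> and
    \<open>g v\<close>.\<close>
  define h where "h z = g (scale z v)" for z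
  have "h field_differentiable (at z)" for z
  proof -
    obtain D where D: "(g has_derivative D) (at (scale z v))" "Vector_Spaces.linear scale (*) D"
      using deriv by blast
    have "((\<lambda>z. Re z *\<^sub>R v + Im z *\<^sub>R scale \<i> v) has_derivative
        (\<lambda>z. Re z *\<^sub>R v + Im z *\<^sub>R scale \<i> v)) (at z)"
      by (auto intro!: derivative_eq_intros)
    then have "((\<lambda>z. scale z v) has_derivative (\<lambda>z. scale z v)) (at z)"
      by (simp only: scale_split[symmetric])
    then have "(h has_derivative (\<lambda>t. D (scale t v))) (at z)"
      unfolding h_def using D(1) by (rule has_derivative_compose)
    \<comment> \<open>Here complex linearity of \<open>D\<close> enters: the real derivative along
      the line is multiplication by a complex number, hence a complex derivative.\<close>
    moreover have "(\<lambda>t. D (scale t v)) = (*) (D v)"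
      using module_hom.scale[OF D(2)[folded module_hom_iff_linear]] by (simp add: mult.commute fun_eq_iff)
    ultimately have "(h has_field_derivative D v) (at z)"
      by (simp add: has_field_derivative_def)
    then show ?thesis
      using field_differentiable_def by blast
  qed
  then have "h holomorphic_on UNIV"
    by (simp add: holomorphic_on_def)
  moreover have "bounded (range h)"
    using \<open>bounded (range g)\<close> by (rule bounded_subset) (auto simp: h_def)
  ultimately obtain c where "\<And>z. h z = c"
    using Liouville_theorem unfolding constant_on_def by blast
  from this[of 0] this[of 1] show ?thesis
    by (simp add: h_def)
qed

end

section \<open>Composition of holomorphic maps\<close>

text \<open>
  All that composing holomorphic maps requires of the charts; it avoids having to show that a flat
  bundle is a complex manifold.
\<close>

definition proper_charts :: "('a, 'm, 'z) cmanifold_scheme \<Rightarrow> bool" where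
  "proper_charts M \<longleftrightarrow> (\<Union>(C, \<phi>)\<in>charts M. C) = points M \<and> (\<forall>(C, \<phi>)\<in>charts M. inj_on \<phi> C)"

lemma proper_charts_subset: "proper_charts M \<Longrightarrow> (C, \<phi>) \<in> charts M \<Longrightarrow> C \<subseteq> points M"
  by (auto simp: proper_charts_def)

lemma proper_charts_inj: "proper_charts M \<Longrightarrow> (C, \<phi>) \<in> charts M \<Longrightarrow> inj_on \<phi> C"
  by (auto simp: proper_charts_def)

lemma proper_charts_cover:
  assumes "proper_charts M" "x \<in> points M"
  obtains C \<phi> where "(C, \<phi>) \<in> charts M" "x \<in> C"
proof -
  have "x \<in> (\<Union>(C, \<phi>)\<in>charts M. C)"
    using assms by (simp add: proper_charts_def)
  then show ?thesis
    using that by auto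
qed

lemma complex_manifold_proper_charts:
  assumes "complex_manifold s M"
  shows "proper_charts M"
proof -
  have "inj_on \<phi> C" if "(C, \<phi>) \<in> charts M" for C \<phi>
  proof -
    have "openin (mtop M) C" "homeomorphic_map (subtopology (mtop M) C) (top_of_set (\<phi> ` C)) \<phi>"
      using assms that by (auto simp: complex_manifold_def)
    then show ?thesis
      by (metis homeomorphic_imp_injective_map openin_subset topspace_subtopology_subset)
  qed
  then show ?thesis
    using assms by (auto simp: complex_manifold_def proper_charts_def)
qed

lemma holo_on_cong:
  assumes "holo_on s t f U" "\<And>z. z \<in> U \<Longrightarrow> f z = g z"
  shows "holo_on s t g U"
  using assms has_derivative_transform_within_open unfolding holo_on_def by blast

lemma holomorphic_map_chart:
  assumes "holomorphic_map s t M N f" and "(C, \<phi>) \<in> charts M" and "(D, \<psi>) \<in> charts N"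
  shows "holo_on s t (\<lambda>w. \<psi> (f (inv_into C \<phi> w))) (\<phi> ` {x \<in> C. f x \<in> D})"
  using assms by (auto simp: holomorphic_map_def)

lemma holomorphic_map_points:
  assumes "holomorphic_map s t M N f" and "x \<in> points M"
  shows "f x \<in> points N"
  using assms continuous_map_funspace unfolding holomorphic_map_def by blast

lemma holomorphic_map_cong:
  assumes f: "holomorphic_map s t M N f" and M: "proper_charts M"
    and fg: "\<And>x. x \<in> points M \<Longrightarrow> f x = g x"
  shows "holomorphic_map s t M N g"
  unfolding holomorphic_map_def
proof (intro conjI ballI, safe)
  show "continuous_map (mtop M) (mtop N) g"
    using f fg continuous_map_eq[of "mtop M" "mtop N" f g] by (simp add: holomorphic_map_def)
  fix C \<phi> D \<psi> assume C: "(C, \<phi>) \<in> charts M" and D: "(D, \<psi>) \<in> charts N"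
  have eq: "{x \<in> C. f x \<in> D} = {x \<in> C. g x \<in> D}"
    using proper_charts_subset[OF M C] fg by auto
  have holo: "holo_on s t (\<lambda>w. \<psi> (f (inv_into C \<phi> w))) (\<phi> ` {x \<in> C. g x \<in> D})"
    using holomorphic_map_chart[OF f C D] by (simp only: eq)
  show "holo_on s t (\<lambda>w. \<psi> (g (inv_into C \<phi> w))) (\<phi> ` {x \<in> C. g x \<in> D})"
    by (rule holo_on_cong[OF holo])
      (use proper_charts_inj[OF M C] proper_charts_subset[OF M C] fg in \<open>auto simp: inv_into_f_f\<close>)
qed

text \<open>Near each point an intermediate chart of \<open>N\<close> factors the coordinate
  expression of the composite, and the chain rule applies. Since that chart varies with the point,
  openness of the whole coordinate domain is also assembled from these neighbourhoods.\<close>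

lemma holomorphic_map_compose:
  assumes f: "holomorphic_map s t M N f" and g: "holomorphic_map t u N P g"
    and M: "proper_charts M" and N: "proper_charts N"
  shows "holomorphic_map s u M P (g \<circ> f)"
  unfolding holomorphic_map_def
proof (intro conjI ballI, safe)
  show "continuous_map (mtop M) (mtop P) (g \<circ> f)"
    using f g continuous_map_compose by (auto simp: holomorphic_map_def)
  fix C \<phi> D \<psi> assume C: "(C, \<phi>) \<in> charts M" and D: "(D, \<psi>) \<in> charts P"
  let ?F = "\<lambda>w. \<psi> ((g \<circ> f) (inv_into C \<phi> w))"
  let ?U = "\<phi> ` {x \<in> C. (g \<circ> f) x \<in> D}"
  note injC = proper_charts_inj[OF M C]
  have local: "\<exists>W D. open W \<and> z \<in> W \<and> W \<subseteq> ?U \<and> (?F has_derivative D) (at z) \<and>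
      Vector_Spaces.linear s u D" if z: "z \<in> ?U" for z
  proof -
    obtain x where x: "z = \<phi> x" "x \<in> C" "g (f x) \<in> D"
      using z by auto
    have "f x \<in> points N"
      using holomorphic_map_points[OF f] x proper_charts_subset[OF M C] by blast
    then obtain B \<theta> where B: "(B, \<theta>) \<in> charts N" and fx: "f x \<in> B"
      using proper_charts_cover[OF N] by metis
    note injB = proper_charts_inj[OF N B]
    define A1 where "A1 = \<phi> ` {x \<in> C. f x \<in> B}"
    define F1 where "F1 w = \<theta> (f (inv_into C \<phi> w))" for w
    define A2 where "A2 = \<theta> ` {y \<in> B. g y \<in> D}"
    define F2 where "F2 w = \<psi> (g (inv_into B \<theta> w))" for w
    have h1: "holo_on s t F1 A1"
      unfolding A1_def F1_def by (rule holomorphic_map_chart[OF f C B])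
    have h2: "holo_on t u F2 A2"
      unfolding A2_def F2_def by (rule holomorphic_map_chart[OF g B D])
    have "continuous_on A1 F1"
      using h1 has_derivative_continuous continuous_at_imp_continuous_on
      unfolding holo_on_def by blast
    \<comment> \<open>On \<open>W\<close> both coordinate expressions are defined and their
      composite equals \<open>?F\<close>; \<open>W\<close> is open because \<open>F1\<close> is
      continuous on the open set \<open>A1\<close>.\<close>
    define W where "W = A1 \<inter> F1 -` A2"
    have "open W"
      unfolding W_def using h1 h2 \<open>continuous_on A1 F1\<close>
      by (auto simp: holo_on_def intro: continuous_open_preimage)
    have zA1: "z \<in> A1" and zA2: "F1 z \<in> A2"
      using x fx injC by (auto simp: A1_def A2_def F1_def)
    have W: "w \<in> ?U \<and> F2 (F1 w) = ?F w" if "w \<in> W" for w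
    proof -
      obtain x' where x': "w = \<phi> x'" "x' \<in> C" "f x' \<in> B"
        using \<open>w \<in> W\<close> by (auto simp: W_def A1_def)
      moreover have "g (f x') \<in> D"
        using \<open>w \<in> W\<close> x' injC injB by (auto simp: W_def A2_def F1_def dest: inj_onD)
      ultimately show ?thesis
        using injC injB by (auto simp: F1_def F2_def)
    qed
    obtain D1 where D1: "(F1 has_derivative D1) (at z)" "Vector_Spaces.linear s t D1"
      using h1 zA1 by (auto simp: holo_on_def)
    obtain D2 where D2: "(F2 has_derivative D2) (at (F1 z))" "Vector_Spaces.linear t u D2"
      using h2 zA2 by (auto simp: holo_on_def)
    have "((\<lambda>w. F2 (F1 w)) has_derivative (\<lambda>w. D2 (D1 w))) (at z)"
      using D1(1) D2(1) by (rule has_derivative_compose)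
    then have "(?F has_derivative (\<lambda>w. D2 (D1 w))) (at z)"
      by (rule has_derivative_transform_within_open[OF _ \<open>open W\<close>])
        (use zA1 zA2 W in \<open>auto simp: W_def\<close>)
    moreover have "Vector_Spaces.linear s u (\<lambda>w. D2 (D1 w))"
      using Vector_Spaces.linear_compose[OF D1(2) D2(2)] by (simp add: o_def)
    ultimately show ?thesis
      using \<open>open W\<close> zA1 zA2 W by (intro exI[of _ W]) (auto simp: W_def)
  qed
  have "open ?U"
    using local by (subst open_subopen) blast
  then show "holo_on s u ?F ?U"
    using local unfolding holo_on_def by blast
qed

text \<open>The double \<open>inv_into\<close> is known to agree with \<open>f\<close> only on
  \<open>points M\<close>, which is enough by \<open>holomorphic_map_cong\<close>.\<close>

lemma biholomorphic_map_inv: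
  assumes "biholomorphic_map s t M N f" and "proper_charts M"
  shows "biholomorphic_map t s N M (inv_into (points M) f)"
proof -
  have f: "bij_betw f (points M) (points N)" "holomorphic_map s t M N f"
      "holomorphic_map t s N M (inv_into (points M) f)"
    using assms(1) by (auto simp: biholomorphic_map_def)
  have "holomorphic_map s t M N (inv_into (points N) (inv_into (points M) f))"
    using holomorphic_map_cong[OF f(2) assms(2)] inv_into_inv_into_eq[OF f(1)] by metis
  then show ?thesis
    using f bij_betw_inv_into by (auto simp: biholomorphic_map_def)
qed

text \<open>Elements of the group are \<open>undefined\<close> off \<open>points E\<close>, whereas
  composites and inverses are computed with unrestricted functions; this lemma passes from one form
  to the other.\<close>

lemma biholomorphic_map_cong:
  assumes "biholomorphic_map s t M N f" and "proper_charts M"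
    and fg: "\<And>x. x \<in> points M \<Longrightarrow> f x = g x"
  shows "biholomorphic_map s t M N g"
proof -
  have "bij_betw f (points M) (points N) = bij_betw g (points M) (points N)"
    using fg by (rule bij_betw_cong)
  \<comment> \<open>\<open>inv_into\<close> consults its function only on the given set, so the two
    inverses are equal everywhere.\<close>
  moreover have "inv_into (points M) f = inv_into (points M) g"
    by (simp add: inv_into_def fg cong: conj_cong)
  ultimately show ?thesis
    using assms holomorphic_map_cong[OF _ assms(2) fg] by (auto simp: biholomorphic_map_def)
qed

lemma biholomorphic_map_compose:
  assumes f: "biholomorphic_map s t M N f" and g: "biholomorphic_map t u N P g"
    and M: "proper_charts M" and N: "proper_charts N" and P: "proper_charts P"
  shows "biholomorphic_map s u M P (g \<circ> f)"
proof -
  have bij: "bij_betw f (points M) (points N)" "bij_betw g (points N) (points P)"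
    using f g by (auto simp: biholomorphic_map_def)
  have "inv_into (points M) f (inv_into (points N) g x) = inv_into (points M) (g \<circ> f) x"
    if "x \<in> points P" for x
    using inv_into_comp[of g f "points M" x] bij that by (simp add: bij_betw_def)
  note inv = this
  have "holomorphic_map u s P M (inv_into (points M) f \<circ> inv_into (points N) g)"
    using f g holomorphic_map_compose[OF _ _ P N] by (auto simp: biholomorphic_map_def)
  then have "holomorphic_map u s P M (inv_into (points M) (g \<circ> f))"
    by (rule holomorphic_map_cong[OF _ P]) (simp add: inv)
  then show ?thesis
    using f g bij holomorphic_map_compose[OF _ _ M N] bij_betw_trans[OF bij]
    by (auto simp: biholomorphic_map_def)
qed

text \<open>In charts the identity is a transition map, so its holomorphy is the chart compatibility
  contained in \<open>complex_manifold\<close>; \<open>proper_charts\<close> does not provide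
  this.\<close>

lemma biholomorphic_map_id:
  assumes "complex_manifold s M"
  shows "biholomorphic_map s s M M (\<lambda>x\<in>points M. x)"
proof -
  note M = complex_manifold_proper_charts[OF assms]
  have "holomorphic_map s s M M id"
    using assms unfolding holomorphic_map_def complex_manifold_def
    by (auto simp: Int_def)
  moreover have "inv_into (points M) id x = id x" if "x \<in> points M" for x
    using that inv_into_f_f[of id "points M" x] by simp
  ultimately have "biholomorphic_map s s M M id"
    using holomorphic_map_cong[OF _ M, of s s M id "inv_into (points M) id"]
    by (simp add: biholomorphic_map_def)
  then show ?thesis
    by (rule biholomorphic_map_cong[OF _ M]) simp
qed

lemma openin_quotient_topology:
  "openin (quotient_topology q) U \<longleftrightarrow> U \<subseteq> range q \<and> open (q -` U)"
proof -
  have "istopology (\<lambda>U. U \<subseteq> range q \<and> open (q -` U))"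
    unfolding istopology_def by (auto simp: vimage_Int vimage_Union)
  then show ?thesis
    by (simp add: quotient_topology_def topology_inverse')
qed

lemma topspace_quotient_topology: "topspace (quotient_topology q) = range q"
proof -
  have "openin (quotient_topology q) (range q)"
    by (simp add: openin_quotient_topology vimage_def)
  moreover have "topspace (quotient_topology q) \<subseteq> range q"
    using openin_topspace[of "quotient_topology q"]
    unfolding openin_quotient_topology by (rule conjunct1)
  ultimately show ?thesis
    using openin_subset by blast
qed

section \<open>Lifts of translations\<close>

text \<open>The algebra of \<open>L\<close> and its cosets alone, shared by
  \<open>torus_bundle\<close> and \<open>flat\<close>, both of which obtain it from the lattice
  condition.\<close>

locale vector_subgroup =
  fixes L :: "'v::real_normed_vector set"
  assumes zero_mem: "0 \<in> L" and diff_mem: "l \<in> L \<Longrightarrow> m \<in> L \<Longrightarrow> l - m \<in> L"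
begin

lemma minus_mem: "l \<in> L \<Longrightarrow> - l \<in> L"
  using diff_mem[OF zero_mem] by simp

lemma add_mem: "l \<in> L \<Longrightarrow> m \<in> L \<Longrightarrow> l + m \<in> L"
  using diff_mem[of l "- m"] minus_mem by simp

lemma coset_eq_iff: "v +o L = w +o L \<longleftrightarrow> w - v \<in> L"
proof
  assume "v +o L = w +o L"
  then have "w \<in> v +o L"
    using zero_mem by (force simp: elt_set_plus_def)
  then show "w - v \<in> L"
    by (auto simp: elt_set_plus_def)
next
  assume d: "w - v \<in> L"
  have "\<exists>m\<in>L. v + l = w + m" if "l \<in> L" for l
    using diff_mem[OF that d] by (intro bexI[of _ "l - (w - v)"]) auto
  moreover have "\<exists>m\<in>L. w + l = v + m" if "l \<in> L" for l
    using add_mem[OF that d] by (intro bexI[of _ "l + (w - v)"]) auto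
  ultimately show "v +o L = w +o L"
    unfolding elt_set_plus_def by blast
qed

lemma coset_add: "(v +o L) + (w +o L) = (v + w) +o L"
proof -
  have "L + L = L"
    using add_mem zero_mem by (force simp: set_plus_def)
  then show ?thesis
    by (simp add: set_plus_rearrange)
qed

lemma points_torus: "points (torus L) = range (\<lambda>v. v +o L)"
  by (simp add: torus_def topspace_quotient_topology)

lemma torus_cases:
  assumes "x \<in> points (torus L)"
  obtains v where "x = v +o L"
  using assms by (auto simp: points_torus)

lemma coset_mem_torus [simp]: "v +o L \<in> points (torus L)"
  by (simp add: points_torus)

lemma translation_coset: "translation (w +o L) (v +o L) = (v + w) +o L"
  by (simp add: translation_def coset_add)

lemma lattice_mem_torus: "L \<in> points (torus L)"
  using coset_mem_torus[of 0] by simp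

lemma translation_lattice: "z \<in> points (torus L) \<Longrightarrow> translation L z = z"
  using translation_coset[of 0] by (auto simp: points_torus)

lemma translation_translation: "translation x (translation y z) = translation (y + x) z"
  by (simp add: translation_def add.assoc)

lemma torus_add_mem: "x \<in> points (torus L) \<Longrightarrow> y \<in> points (torus L) \<Longrightarrow> x + y \<in> points (torus L)"
  by (auto simp: points_torus coset_add)

lemma translation_inverse:
  assumes "z \<in> points (torus L)"
  shows "translation ((- v) +o L) (translation (v +o L) z) = z"
    and "translation (v +o L) (translation ((- v) +o L) z) = z"
proof -
  obtain w where "z = w +o L"
    using assms by (rule torus_cases)
  then show "translation ((- v) +o L) (translation (v +o L) z) = z"
    and "translation (v +o L) (translation ((- v) +o L) z) = z"
    by (simp_all add: translation_coset)
qed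

end

section \<open>The group of lifts\<close>

locale torus_bundle = complex_fd_space scale
  for scale :: "complex \<Rightarrow> 'v::real_normed_vector \<Rightarrow> 'v" +
  fixes L :: "'v set" and E :: "('e, 'v \<times> complex, 'v set) line_bundle"
  assumes lattice: "torus_lattice scale L"
    and line_bundle: "holomorphic_line_bundle scale (torus L) E"
begin

sublocale vector_subgroup L
  using lattice by unfold_locales (auto simp: torus_lattice_def)

lemma manifold_E: "complex_manifold (prod_scale scale) E"
  using line_bundle by (simp add: holomorphic_line_bundle_def)

lemma charts_E: "proper_charts E"
  using manifold_E by (rule complex_manifold_proper_charts)

lemma holomorphic_proj: "holomorphic_map (prod_scale scale) scale E (torus L) (proj E)"
  using line_bundle by (simp add: holomorphic_line_bundle_def)

lemma proj_mem: "e \<in> points E \<Longrightarrow> proj E e \<in> points (torus L)"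
  using holomorphic_proj by (rule holomorphic_map_points)

lemma fibre_closed:
  assumes "z \<in> points (torus L)"
  shows "\<forall>a\<in>fibre E z. \<forall>b\<in>fibre E z. fadd E a b \<in> fibre E z"
    and "\<forall>k. \<forall>a\<in>fibre E z. fscale E k a \<in> fibre E z"
  using line_bundle assms by (simp_all add: holomorphic_line_bundle_def)

lemma fibre_mem_torus: "a \<in> fibre E z \<Longrightarrow> z \<in> points (torus L)"
  using proj_mem by (auto simp: fibre_def)

lemma fadd_fibre:
  "a \<in> fibre E z \<Longrightarrow> b \<in> fibre E z \<Longrightarrow> fadd E a b \<in> fibre E z"
  using fibre_closed(1) fibre_mem_torus by blast

lemma fscale_fibre: "a \<in> fibre E z \<Longrightarrow> fscale E k a \<in> fibre E z"
  using fibre_closed(2) fibre_mem_torus by blast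

text \<open>A membership criterion that does not ask for bijectivity on fibres: this follows from
  bijectivity on the total space and invertibility of the translation on the base. It serves the
  composite, the inverse and the identity alike.\<close>

lemma restrict_mem_translation_lifts:
  assumes h: "biholomorphic_map (prod_scale scale) (prod_scale scale) E E h"
    and x: "x \<in> points (torus L)"
    and proj: "\<And>e. e \<in> points E \<Longrightarrow> proj E (h e) = translation x (proj E e)"
    and add: "\<And>z a b. a \<in> fibre E z \<Longrightarrow> b \<in> fibre E z \<Longrightarrow> h (fadd E a b) = fadd E (h a) (h b)"
    and scale: "\<And>a k. a \<in> points E \<Longrightarrow> h (fscale E k a) = fscale E k (h a)"
  shows "restrict h (points E) \<in> translation_lifts scale L E"
proof -
  let ?h = "restrict h (points E)"
  have bihol: "biholomorphic_map (prod_scale scale) (prod_scale scale) E E ?h"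
    by (rule biholomorphic_map_cong[OF h charts_E]) simp
  then have bij: "bij_betw ?h (points E) (points E)"
    by (simp add: biholomorphic_map_def)
  obtain v where v: "x = v +o L"
    using x by (rule torus_cases)
  have fib: "?h ` fibre E z = fibre E (translation x z)" if z: "z \<in> points (torus L)" for z
  proof
    show "?h ` fibre E z \<subseteq> fibre E (translation x z)"
      using bij proj by (auto simp: fibre_def dest: bij_betwE)
    show "fibre E (translation x z) \<subseteq> ?h ` fibre E z"
    proof
      fix e assume e: "e \<in> fibre E (translation x z)"
      then obtain a where a: "a \<in> points E" "e = h a"
        using bij by (auto simp: fibre_def bij_betw_def)
      \<comment> \<open>The preimage \<open>a\<close> lies over \<open>z\<close> because translation
        by the coset of \<open>v\<close> is undone by translation by the coset of
        \<open>- v\<close>.\<close>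
      then have "translation x (proj E a) = translation x z"
        using e proj by (auto simp: fibre_def)
      then have "proj E a = z"
        using translation_inverse(1)[OF z, of v] translation_inverse(1)[OF proj_mem[OF a(1)], of v]
        by (simp add: v)
      then show "e \<in> ?h ` fibre E z"
        using a by (auto simp: fibre_def)
    qed
  qed
  have "bij_betw ?h (fibre E z) (fibre E (translation x z))" if "z \<in> points (torus L)" for z
    by (rule bij_betw_subset[OF bij _ fib[OF that]]) (auto simp: fibre_def)
  moreover have "fibre_linear E E ?h z (translation x z)" if "z \<in> points (torus L)" for z
  proof -
    have "fibre E z \<subseteq> points E"
      by (auto simp: fibre_def)
    then have "?h (fadd E a b) = fadd E (?h a) (?h b)" "?h (fscale E k a) = fscale E k (?h a)"
      if "a \<in> fibre E z" "b \<in> fibre E z" for a b k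
      using that add[OF that] scale[of a k] fadd_fibre[OF that] fscale_fibre[OF that(1), of k] by auto
    moreover have "?h \<in> fibre E z \<rightarrow> fibre E (translation x z)"
      using fib[OF that] by blast
    ultimately show ?thesis
      unfolding fibre_linear_def by blast
  qed
  ultimately show ?thesis
    using bihol x proj unfolding translation_lifts_def by (auto intro!: bexI[of _ x])
qed

text \<open>The side condition on base points disappears: a fibre containing an element lies over a
  point of the torus, and each point of \<open>E\<close> lies in its own fibre.\<close>

lemma translation_liftsE:
  assumes "u \<in> translation_lifts scale L E"
  obtains v where "u \<in> Bij (points E)"
    and "biholomorphic_map (prod_scale scale) (prod_scale scale) E E u"
    and "\<And>e. e \<in> points E \<Longrightarrow> u e \<in> points E"
    and "\<And>e. e \<in> points E \<Longrightarrow> proj E (u e) = translation (v +o L) (proj E e)"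
    and "\<And>z a b. a \<in> fibre E z \<Longrightarrow> b \<in> fibre E z \<Longrightarrow> u (fadd E a b) = fadd E (u a) (u b)"
    and "\<And>a k. a \<in> points E \<Longrightarrow> u (fscale E k a) = fscale E k (u a)"
proof -
  obtain x where u: "u \<in> extensional (points E)"
      "biholomorphic_map (prod_scale scale) (prod_scale scale) E E u"
    and x: "x \<in> points (torus L)"
    and proj: "\<forall>e\<in>points E. proj E (u e) = translation x (proj E e)"
    and lin: "\<forall>z\<in>points (torus L). fibre_linear E E u z (translation x z)"
    using assms unfolding translation_lifts_def by blast
  obtain v where v: "x = v +o L"
    using x by (rule torus_cases)
  have bij: "bij_betw u (points E) (points E)"
    using u by (simp add: biholomorphic_map_def)
  show ?thesis
  proof (rule that)
    show "u \<in> Bij (points E)"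
      using u bij by (simp add: Bij_def)
    show "u e \<in> points E" if "e \<in> points E" for e
      using bij that by (rule bij_betw_apply)
    show "proj E (u e) = translation (v +o L) (proj E e)" if "e \<in> points E" for e
      using proj that v by blast
    show "u (fadd E a b) = fadd E (u a) (u b)" if "a \<in> fibre E z" "b \<in> fibre E z" for z a b
      using lin fibre_mem_torus that unfolding fibre_linear_def by blast
    show "u (fscale E k a) = fscale E k (u a)" if "a \<in> points E" for a k
    proof -
      have "a \<in> fibre E (proj E a)"
        using that by (simp add: fibre_def)
      then show ?thesis
        using lin fibre_mem_torus unfolding fibre_linear_def by blast
    qed
  qed (fact u(2))
qed

lemma compose_mem_translation_lifts:
  assumes "u \<in> translation_lifts scale L E" and "w \<in> translation_lifts scale L E"
  shows "compose (points E) u w \<in> translation_lifts scale L E"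
proof -
  obtain x where u: "biholomorphic_map (prod_scale scale) (prod_scale scale) E E u"
      "\<And>e. e \<in> points E \<Longrightarrow> proj E (u e) = translation (x +o L) (proj E e)"
      "\<And>z a b. a \<in> fibre E z \<Longrightarrow> b \<in> fibre E z \<Longrightarrow> u (fadd E a b) = fadd E (u a) (u b)"
      "\<And>a k. a \<in> points E \<Longrightarrow> u (fscale E k a) = fscale E k (u a)"
    using translation_liftsE[OF assms(1)] by metis
  obtain y where w: "biholomorphic_map (prod_scale scale) (prod_scale scale) E E w"
      "\<And>e. e \<in> points E \<Longrightarrow> w e \<in> points E"
      "\<And>e. e \<in> points E \<Longrightarrow> proj E (w e) = translation (y +o L) (proj E e)"
      "\<And>z a b. a \<in> fibre E z \<Longrightarrow> b \<in> fibre E z \<Longrightarrow> w (fadd E a b) = fadd E (w a) (w b)"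
      "\<And>a k. a \<in> points E \<Longrightarrow> w (fscale E k a) = fscale E k (w a)"
    using translation_liftsE[OF assms(2)] by metis
  have "restrict (u \<circ> w) (points E) \<in> translation_lifts scale L E"
  proof (rule restrict_mem_translation_lifts[where x = "(y +o L) + (x +o L)"])
    show "biholomorphic_map (prod_scale scale) (prod_scale scale) E E (u \<circ> w)"
      by (rule biholomorphic_map_compose[OF w(1) u(1) charts_E charts_E charts_E])
    show "(u \<circ> w) (fadd E a b) = fadd E ((u \<circ> w) a) ((u \<circ> w) b)"
      if "a \<in> fibre E z" "b \<in> fibre E z" for z a b
    proof -
      have "w a \<in> fibre E (translation (y +o L) z)" "w b \<in> fibre E (translation (y +o L) z)"
        using that w by (auto simp: fibre_def)
      then show ?thesis
        using that u(3) w(4) by simp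
    qed
  qed (use u w in \<open>auto simp: torus_add_mem translation_translation\<close>)
  then show ?thesis
    by (simp add: compose_def o_def)
qed

lemma inv_mem_translation_lifts:
  assumes "u \<in> translation_lifts scale L E"
  shows "(\<lambda>e\<in>points E. inv_into (points E) u e) \<in> translation_lifts scale L E"
proof -
  obtain x where u: "u \<in> Bij (points E)" "biholomorphic_map (prod_scale scale) (prod_scale scale) E E u"
      "\<And>e. e \<in> points E \<Longrightarrow> u e \<in> points E"
      "\<And>e. e \<in> points E \<Longrightarrow> proj E (u e) = translation (x +o L) (proj E e)"
      "\<And>z a b. a \<in> fibre E z \<Longrightarrow> b \<in> fibre E z \<Longrightarrow> u (fadd E a b) = fadd E (u a) (u b)"
      "\<And>a k. a \<in> points E \<Longrightarrow> u (fscale E k a) = fscale E k (u a)"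
    using translation_liftsE[OF assms] by metis
  let ?i = "inv_into (points E) u"
  have bij: "bij_betw u (points E) (points E)"
    using u(1) by (simp add: Bij_def)
  have i: "?i e \<in> points E" "u (?i e) = e" if "e \<in> points E" for e
    using bij that by (simp_all add: bij_betw_def inv_into_into f_inv_into_f)
  have iu: "?i (u e) = e" if "e \<in> points E" for e
    using bij that by (simp add: bij_betw_def)
  have proj: "proj E (?i e) = translation ((- x) +o L) (proj E e)" if "e \<in> points E" for e
    using u(4)[OF i(1)[OF that]] i(2)[OF that] translation_inverse(1) proj_mem[OF i(1)[OF that]]
    by simp
  show ?thesis
  proof (rule restrict_mem_translation_lifts[where x = "(- x) +o L"])
    show "biholomorphic_map (prod_scale scale) (prod_scale scale) E E ?i"
      by (rule biholomorphic_map_inv[OF u(2) charts_E])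
    show "?i (fadd E a b) = fadd E (?i a) (?i b)" if ab: "a \<in> fibre E z" "b \<in> fibre E z" for z a b
    proof -
      have ib: "?i a \<in> fibre E (translation ((- x) +o L) z)" "?i b \<in> fibre E (translation ((- x) +o L) z)"
        using ab proj i by (auto simp: fibre_def)
      \<comment> \<open>Additivity of the inverse comes from applying \<open>u\<close> to the
        proposed sum and cancelling; closure of the fibres under addition keeps that sum where
        \<open>?i\<close> undoes \<open>u\<close>.\<close>
      then have "u (fadd E (?i a) (?i b)) = fadd E a b"
        using u(5)[OF ib] i(2) ab by (auto simp: fibre_def)
      then show ?thesis
        using iu[of "fadd E (?i a) (?i b)"] fadd_fibre[OF ib] by (simp add: fibre_def)
    qed
    show "?i (fscale E k a) = fscale E k (?i a)" if a: "a \<in> points E" for a k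
    proof -
      have "fscale E k (?i a) \<in> points E"
        using fscale_fibre[of "?i a" "proj E (?i a)" k] i(1)[OF a] by (simp add: fibre_def)
      then show ?thesis
        using iu[of "fscale E k (?i a)"] u(6)[OF i(1)[OF a]] i(2)[OF a] by simp
    qed
  qed (use proj in auto)
qed

lemma id_mem_translation_lifts: "(\<lambda>e\<in>points E. e) \<in> translation_lifts scale L E"
proof -
  have "restrict (\<lambda>e\<in>points E. e) (points E) \<in> translation_lifts scale L E"
  proof (rule restrict_mem_translation_lifts[where x = L])
    show "biholomorphic_map (prod_scale scale) (prod_scale scale) E E (\<lambda>e\<in>points E. e)"
      by (rule biholomorphic_map_id[OF manifold_E])
    show "(\<lambda>e\<in>points E. e) (fadd E a b) = fadd E ((\<lambda>e\<in>points E. e) a) ((\<lambda>e\<in>points E. e) b)"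
      if "a \<in> fibre E z" "b \<in> fibre E z" for z a b
      using that fadd_fibre[OF that] by (simp add: fibre_def)
    show "(\<lambda>e\<in>points E. e) (fscale E k a) = fscale E k ((\<lambda>e\<in>points E. e) a)"
      if "a \<in> points E" for a k
      using that fscale_fibre[of a "proj E a" k] by (simp add: fibre_def)
  qed (simp_all add: translation_lattice lattice_mem_torus proj_mem)
  then show ?thesis
    by simp
qed

text \<open>\<open>comm_group\<close> includes the group axioms. As \<open>S_group\<close> changes
  only the carrier of \<open>BijGroup\<close>, they follow once the lifts are a subgroup.\<close>

lemma translation_lifts_subgroup: "subgroup (translation_lifts scale L E) (BijGroup (points E))"
proof -
  have sub: "translation_lifts scale L E \<subseteq> Bij (points E)"
    using translation_liftsE by blast
  interpret group "BijGroup (points E)"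
    by (rule group_BijGroup)
  show ?thesis
  proof (rule subgroupI)
    show "translation_lifts scale L E \<subseteq> carrier (BijGroup (points E))"
      using sub by (simp add: BijGroup_def)
    show "translation_lifts scale L E \<noteq> {}"
      using id_mem_translation_lifts by blast
    show "inv\<^bsub>BijGroup (points E)\<^esub> u \<in> translation_lifts scale L E"
      if "u \<in> translation_lifts scale L E" for u
      using inv_mem_translation_lifts[OF that] sub that by (simp add: inv_BijGroup subset_iff)
    show "u \<otimes>\<^bsub>BijGroup (points E)\<^esub> w \<in> translation_lifts scale L E"
      if "u \<in> translation_lifts scale L E" "w \<in> translation_lifts scale L E" for u w
      using compose_mem_translation_lifts[OF that] sub that by (simp add: BijGroup_def subset_iff)
  qed
qed

lemma S_group_group: "group (S_group scale L E)"
  unfolding S_group_def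
  by (rule group.subgroup_imp_group[OF group_BijGroup translation_lifts_subgroup])

end

section \<open>Flat bundles\<close>

locale flat = complex_fd_space scale
  for scale :: "complex \<Rightarrow> 'v::real_normed_vector \<Rightarrow> 'v" +
  fixes L :: "'v set" and \<alpha> :: "'v \<Rightarrow> complex"
  assumes lattice: "torus_lattice scale L"
    and unitary: "unitary_character L \<alpha>"
begin

sublocale vector_subgroup L
  using lattice by unfold_locales (auto simp: torus_lattice_def)

abbreviation orbit :: "'v \<Rightarrow> complex \<Rightarrow> ('v \<times> complex) set" where
  "orbit v c \<equiv> flat_orbit L \<alpha> (v, c)"

abbreviation F :: "(('v \<times> complex) set, 'v \<times> complex, 'v set) line_bundle" where
  "F \<equiv> flat_bundle L \<alpha>"

lemma character_add: "l \<in> L \<Longrightarrow> m \<in> L \<Longrightarrow> \<alpha> (l + m) = \<alpha> l * \<alpha> m"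
  using unitary by (simp add: unitary_character_def)

lemma character_nonzero: "l \<in> L \<Longrightarrow> \<alpha> l \<noteq> 0"
  using unitary by (force simp: unitary_character_def)

lemma character_zero: "\<alpha> 0 = 1"
  using character_add[OF zero_mem zero_mem] character_nonzero[OF zero_mem] by simp

lemma mem_orbit: "(w, d) \<in> orbit v c \<longleftrightarrow> w - v \<in> L \<and> d = \<alpha> (w - v) * c"
  by (auto simp: flat_orbit_def intro!: exI[of _ "w - v"])

text \<open>Forward, \<open>(w, d)\<close> lies in its own orbit because
  \<open>\<alpha> 0 = 1\<close>; backward, multiplicativity splits \<open>\<alpha> (t - v)\<close>
  at \<open>w\<close>. For \<open>w = v\<close> it says that the coefficient over a fixed base
  vector is unique.\<close>

lemma orbit_eq_iff: "orbit v c = orbit w d \<longleftrightarrow> w - v \<in> L \<and> d = \<alpha> (w - v) * c"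
proof
  assume "orbit v c = orbit w d"
  moreover have "(w, d) \<in> orbit w d"
    by (simp add: mem_orbit zero_mem character_zero)
  ultimately show "w - v \<in> L \<and> d = \<alpha> (w - v) * c"
    by (metis mem_orbit)
next
  assume wd: "w - v \<in> L \<and> d = \<alpha> (w - v) * c"
  have "(t, b) \<in> orbit v c \<longleftrightarrow> (t, b) \<in> orbit w d" for t b
  proof -
    have "t - v \<in> L \<longleftrightarrow> t - w \<in> L"
      using add_mem[of "t - w" "w - v"] diff_mem[of "t - v" "w - v"] wd by auto
    moreover have "\<alpha> (t - v) = \<alpha> (t - w) * \<alpha> (w - v)" if "t - w \<in> L"
      using character_add[OF that, of "w - v"] wd by simp
    ultimately show ?thesis
      using wd by (auto simp: mem_orbit)
  qed
  then show "orbit v c = orbit w d"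
    by auto
qed

lemma orbit_add: "l \<in> L \<Longrightarrow> orbit (v + l) (\<alpha> l * c) = orbit v c"
  using orbit_eq_iff[of v c "v + l" "\<alpha> l * c"] by simp

lemma points_flat: "points F = range (flat_orbit L \<alpha>)"
  by (simp add: flat_bundle_def topspace_quotient_topology)

lemma orbit_mem [simp]: "orbit v c \<in> points F"
  by (simp add: points_flat)

lemma proj_orbit: "proj F (orbit v c) = v +o L"
  by (auto simp: flat_bundle_def flat_orbit_def elt_set_plus_def image_iff)

lemma fscale_orbit: "fscale F k (orbit v c) = orbit v (k * c)"
  by (auto simp: flat_bundle_def mem_orbit mult.left_commute)

lemma orbit_over_coset:
  assumes "S \<in> points F" and "proj F S = v +o L"
  obtains c where "S = orbit v c"
proof -
  obtain w d where S: "S = orbit w d"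
    using assms by (auto simp: points_flat)
  then have "v - w \<in> L"
    using assms by (simp add: proj_orbit coset_eq_iff)
  then show ?thesis
    using that[of "\<alpha> (v - w) * d"] S by (simp add: orbit_eq_iff)
qed

text \<open>A ball of radius \<epsilon>/2 meets each coset at most once. The fibre factor may be all
  of the complex numbers, since the base vector fixes the coefficient. These strips supply the
  charts used below.\<close>

lemma locally_inj:
  obtains \<epsilon> where "\<epsilon> > 0" and "\<And>l. l \<in> L \<Longrightarrow> norm l < \<epsilon> \<Longrightarrow> l = 0"
    and "\<And>v. inj_on (flat_orbit L \<alpha>) (ball v (\<epsilon> / 2) \<times> UNIV)"
proof -
  obtain \<epsilon> where \<epsilon>: "\<epsilon> > 0" "\<And>l. l \<in> L \<Longrightarrow> norm l < \<epsilon> \<Longrightarrow> l = 0"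
    using discrete_subgroup_separated[OF zero_mem, of thesis] lattice
    by (auto simp: torus_lattice_def)
  have "inj_on (flat_orbit L \<alpha>) (ball v (\<epsilon> / 2) \<times> UNIV)" for v
  proof (rule inj_onI, clarify)
    fix a b c d assume a: "a \<in> ball v (\<epsilon> / 2)" "b \<in> ball v (\<epsilon> / 2)" and eq: "orbit a c = orbit b d"
    have "norm (b - a) < \<epsilon>"
      using a dist_triangle_half_r[of v b \<epsilon> a] by (simp add: dist_norm)
    then have "b - a = 0"
      using \<epsilon>(2) eq orbit_eq_iff by blast
    then show "a = b \<and> c = d"
      using eq by (simp add: orbit_eq_iff character_zero)
  qed
  then show ?thesis
    using that \<epsilon> by blast
qed

lemma flat_chart:
  assumes "open W" and "inj_on (flat_orbit L \<alpha>) W"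
  shows "(flat_orbit L \<alpha> ` W, inv_into W (flat_orbit L \<alpha>)) \<in> charts F"
  using assms by (auto simp: flat_bundle_def quotient_charts_def)

lemma proper_charts_flat: "proper_charts F"
  unfolding proper_charts_def
proof
  obtain \<epsilon> where \<epsilon>: "\<epsilon> > 0" "\<And>v. inj_on (flat_orbit L \<alpha>) (ball v (\<epsilon> / 2) \<times> UNIV)"
    using locally_inj by metis
  have "S \<in> (\<Union>(C, \<phi>)\<in>charts F. C)" if S: "S \<in> points F" for S
  proof -
    obtain v c where vc: "S = orbit v c"
      using S by (auto simp: points_flat)
    have "(v, c) \<in> ball v (\<epsilon> / 2) \<times> UNIV"
      using \<epsilon>(1) by simp
    then have "S \<in> flat_orbit L \<alpha> ` (ball v (\<epsilon> / 2) \<times> UNIV)"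
      unfolding vc by (rule imageI)
    moreover have "open (ball v (\<epsilon> / 2) \<times> (UNIV :: complex set))"
      by (intro open_Times) auto
    note chart = flat_chart[OF this \<epsilon>(2)]
    ultimately show ?thesis
      by (intro UN_I[OF chart]) simp
  qed
  moreover have "C \<subseteq> points F" if "(C, \<phi>) \<in> charts F" for C \<phi>
    using that unfolding points_flat by (auto simp: flat_bundle_def quotient_charts_def)
  ultimately show "(\<Union>(C, \<phi>)\<in>charts F. C) = points F"
    by blast
  show "\<forall>(C, \<phi>)\<in>charts F. inj_on \<phi> C"
    by (auto simp: flat_bundle_def quotient_charts_def intro: inj_on_inv_into)
qed

text \<open>In strip charts around \<open>v\<close> and \<open>v + x\<close> the map sends
  \<open>(y, 1)\<close> to \<open>(y + x, g y)\<close>, so \<open>g\<close> is the second component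
  of a holomorphic coordinate expression along the slice with fibre coordinate 1.\<close>

lemma translation_lift_coefficient:
  assumes holo: "holomorphic_map (prod_scale scale) (prod_scale scale) F F u"
    and u: "\<And>v. u (orbit v 1) = orbit (v + x) (g v)"
  shows "holo_on scale (*) g UNIV"
  unfolding holo_on_def
proof (intro conjI ballI)
  fix v :: 'v
  let ?q = "flat_orbit L \<alpha>"
  obtain \<epsilon> where \<epsilon>: "\<epsilon> > 0" "\<And>l. l \<in> L \<Longrightarrow> norm l < \<epsilon> \<Longrightarrow> l = 0"
    and inj: "\<And>v. inj_on ?q (ball v (\<epsilon> / 2) \<times> UNIV)"
    using locally_inj by metis
  define W where "W = ball v (\<epsilon> / 2) \<times> (UNIV :: complex set)"
  define W' where "W' = ball (v + x) (\<epsilon> / 2) \<times> (UNIV :: complex set)"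
  have W: "open W" "inj_on ?q W" and W': "open W'" "inj_on ?q W'"
    using inj by (simp_all add: W_def W'_def open_Times)
  define H where "H p = inv_into W' ?q (u (?q p))" for p
  define U where "U = {p \<in> W. u (?q p) \<in> ?q ` W'}"
  \<comment> \<open>A chart is itself an \<open>inv_into\<close>, so the inverse chart in
    \<open>holomorphic_map\<close> is a nested one, which on \<open>W\<close> is the quotient map
    again.\<close>
  have inv_q: "inv_into (?q ` W) (inv_into W ?q) p = ?q p" if "p \<in> W" for p
    using inv_into_inv_into_eq[of ?q W "?q ` W" p] W that by (simp add: bij_betw_def)
  have "inv_into W ?q ` {S \<in> ?q ` W. u S \<in> ?q ` W'} = U"
    using W by (force simp: U_def)
  then have "holo_on (prod_scale scale) (prod_scale scale)
      (\<lambda>p. inv_into W' ?q (u (inv_into (?q ` W) (inv_into W ?q) p))) U"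
    using holomorphic_map_chart[OF holo flat_chart[OF W] flat_chart[OF W']] by simp
  then have H: "holo_on (prod_scale scale) (prod_scale scale) H U"
    by (rule holo_on_cong) (simp add: U_def H_def inv_q)
  \<comment> \<open>Both strips have the same radius, so translation by \<open>x\<close> carries one
    ball into the other and the target chart returns exactly the representative
    \<open>(y + x, g y)\<close>.\<close>
  have near: "(y, 1) \<in> U \<and> H (y, 1) = (y + x, g y)" if y: "y \<in> ball v (\<epsilon> / 2)" for y
  proof -
    have "(y + x, g y) \<in> W'"
      using y by (simp add: W'_def dist_norm)
    then show ?thesis
      using y W' by (simp add: U_def H_def W_def u)
  qed
  have v: "v \<in> ball v (\<epsilon> / 2)"
    using \<epsilon>(1) by simp
  obtain D where D: "(H has_derivative D) (at (v, 1))"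
      "Vector_Spaces.linear (prod_scale scale) (prod_scale scale) D"
    using H near[OF v] by (auto simp: holo_on_def)
  have "((\<lambda>y. (y, 1)) has_derivative (\<lambda>y. (y, 0))) (at v)"
    by (auto intro!: derivative_eq_intros)
  then have "((\<lambda>y. H (y, 1)) has_derivative (\<lambda>y. D (y, 0))) (at v)"
    using D(1) by (rule has_derivative_compose)
  then have "((\<lambda>y. snd (H (y, 1))) has_derivative (\<lambda>y. snd (D (y, 0)))) (at v)"
    by (rule has_derivative_snd)
  then have "(g has_derivative (\<lambda>y. snd (D (y, 0)))) (at v)"
    by (rule has_derivative_transform_within_open[OF _ open_ball v]) (simp add: near)
  moreover have "Vector_Spaces.linear scale (*) (\<lambda>y. snd (D (y, 0)))"
  proof -
    interpret D: module_hom "prod_scale scale" "prod_scale scale" D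
      using D(2) by (simp add: module_hom_iff_linear)
    show ?thesis
      unfolding module_hom_iff_linear[symmetric]
    proof
      show "snd (D (a + b, 0)) = snd (D (a, 0)) + snd (D (b, 0))" for a b
        using D.add[of "(a, 0)" "(b, 0)"] by simp
      show "snd (D (scale r a, 0)) = r * snd (D (a, 0))" for r a
        using D.scale[of r "(a, 0)"] by (simp add: prod_scale_def)
    qed
  qed
  ultimately show "\<exists>D. (g has_derivative D) (at v) \<and> Vector_Spaces.linear scale (*) D"
    by blast
qed simp

lemma translation_lift_constant:
  assumes holo: "holomorphic_map (prod_scale scale) (prod_scale scale) F F u"
    and proj: "\<And>S. S \<in> points F \<Longrightarrow> proj F (u S) = translation (x +o L) (proj F S)"
    and scl: "\<And>S k. S \<in> points F \<Longrightarrow> u (fscale F k S) = fscale F k (u S)"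
  obtains c where "\<And>v d. u (orbit v d) = orbit (v + x) (c * d)"
proof -
  \<comment> \<open>The image lies over the coset of \<open>v + x\<close>, hence has a coefficient
    at that base vector. Keeping the representative \<open>x\<close> fixed makes \<open>g\<close> a
    function on all of the vector space.\<close>
  have "\<exists>c. u (orbit v 1) = orbit (v + x) c" for v
    using orbit_over_coset[of "u (orbit v 1)" "v + x"] holomorphic_map_points[OF holo, of "orbit v 1"]
      proj[of "orbit v 1"]
    by (metis orbit_mem proj_orbit translation_coset)
  then obtain g where g: "\<And>v. u (orbit v 1) = orbit (v + x) (g v)"
    by metis
  have "g (v + l) = g v" if l: "l \<in> L" for v l
  proof -
    \<comment> \<open>Seen from the base vector \<open>v + l\<close>, the orbit of
      \<open>(v, 1)\<close> has coefficient \<open>\<alpha> l\<close>. Homogeneity pulls this factor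
      out of \<open>u\<close>, and \<open>orbit_add\<close> absorbs it on the target side.\<close>
    have "orbit (v + x) (g v) = u (orbit (v + l) (\<alpha> l * 1))"
      by (simp only: g orbit_add[OF l])
    also have "\<dots> = u (fscale F (\<alpha> l) (orbit (v + l) 1))"
      by (simp only: fscale_orbit)
    also have "\<dots> = fscale F (\<alpha> l) (u (orbit (v + l) 1))"
      by (rule scl) simp
    also have "\<dots> = orbit (v + x + l) (\<alpha> l * g (v + l))"
      by (simp add: g fscale_orbit add_ac)
    also have "\<dots> = orbit (v + x) (g (v + l))"
      by (rule orbit_add[OF l])
    finally show ?thesis
      by (simp add: orbit_eq_iff character_zero)
  qed
  then have const: "g v = g 0" for v
    using periodic_holomorphic_constant[OF lattice translation_lift_coefficient[OF holo g]] by blast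
  have "u (orbit v d) = orbit (v + x) (g 0 * d)" for v d
  proof -
    have "u (orbit v d) = u (fscale F d (orbit v 1))"
      by (simp add: fscale_orbit)
    also have "\<dots> = fscale F d (u (orbit v 1))"
      by (rule scl) simp
    also have "\<dots> = orbit (v + x) (g 0 * d)"
      by (simp add: g const[of v] fscale_orbit mult.commute)
    finally show ?thesis .
  qed
  then show ?thesis
    by (rule that)
qed

end

section \<open>Transport to the flat bundle and commutativity\<close>

locale flat_torus_bundle = torus_bundle scale L E + flat scale L \<alpha>
  for scale :: "complex \<Rightarrow> 'v::real_normed_vector \<Rightarrow> 'v" and L
    and E :: "('e, 'v \<times> complex, 'v set) line_bundle" and \<alpha> +
  fixes f :: "'e \<Rightarrow> ('v \<times> complex) set"
  assumes iso: "bundle_iso scale E (flat_bundle L \<alpha>) f"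
begin

text \<open>Conjugation by \<open>f\<close> preserves the translation and the homogeneity, because
  \<open>f\<close> covers the identity and is linear on fibres. The conclusion avoids the inverse of
  \<open>f\<close>, so that the formulas for two lifts can be chained.\<close>

lemma translation_lifts_conjugate:
  assumes "u \<in> translation_lifts scale L E"
  obtains x c where "\<And>e v d. e \<in> points E \<Longrightarrow> f e = orbit v d \<Longrightarrow> f (u e) = orbit (v + x) (c * d)"
proof -
  obtain x where u: "biholomorphic_map (prod_scale scale) (prod_scale scale) E E u"
      "\<And>e. e \<in> points E \<Longrightarrow> u e \<in> points E"
      "\<And>e. e \<in> points E \<Longrightarrow> proj E (u e) = translation (x +o L) (proj E e)"
      "\<And>a k. a \<in> points E \<Longrightarrow> u (fscale E k a) = fscale E k (u a)"
    using translation_liftsE[OF assms] by metis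
  let ?i = "inv_into (points E) f"
  have f: "biholomorphic_map (prod_scale scale) (prod_scale scale) E F f"
    and proj_f: "\<And>e. e \<in> points E \<Longrightarrow> proj F (f e) = proj E e"
    and lin_f: "\<And>z. fibre_linear E F f z z"
    using iso by (auto simp: bundle_iso_def)
  have bij: "bij_betw f (points E) (points F)"
    using f by (simp add: biholomorphic_map_def)
  have i: "?i S \<in> points E" "f (?i S) = S" if "S \<in> points F" for S
    using bij that by (simp_all add: bij_betw_def inv_into_into f_inv_into_f)
  have i_f: "?i (f e) = e" if "e \<in> points E" for e
    using bij that by (simp add: bij_betw_def)
  have scale_mem: "fscale E k e \<in> points E" if "e \<in> points E" for k e
    using fscale_fibre[of e "proj E e" k] that by (simp add: fibre_def)
  have scale_f: "f (fscale E k e) = fscale F k (f e)" if "e \<in> points E" for k e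
    using lin_f[of "proj E e"] that by (simp add: fibre_linear_def fibre_def)
  have scale_i: "?i (fscale F k S) = fscale E k (?i S)" if "S \<in> points F" for k S
    using i_f[of "fscale E k (?i S)"] scale_mem scale_f i[OF that] by simp
  have "holomorphic_map (prod_scale scale) (prod_scale scale) F F (f \<circ> (u \<circ> ?i))"
    using f u(1) unfolding biholomorphic_map_def
    by (intro holomorphic_map_compose[OF _ _ proper_charts_flat charts_E]) auto
  moreover have "proj F ((f \<circ> (u \<circ> ?i)) S) = translation (x +o L) (proj F S)"
    if "S \<in> points F" for S
    using u(2,3) proj_f[of "?i S"] proj_f i[OF that] by simp
  moreover have "(f \<circ> (u \<circ> ?i)) (fscale F k S) = fscale F k ((f \<circ> (u \<circ> ?i)) S)"
    if "S \<in> points F" for S k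
    using scale_i[OF that] u(2,4) scale_f i(1)[OF that] by simp
  ultimately obtain c where c: "\<And>v d. (f \<circ> (u \<circ> ?i)) (orbit v d) = orbit (v + x) (c * d)"
    using translation_lift_constant by metis
  show ?thesis
  proof (rule that)
    show "f (u e) = orbit (v + x) (c * d)" if "e \<in> points E" "f e = orbit v d" for e v d
      using c[of v d] i_f[OF that(1)] that(2) by simp
  qed
qed

lemma translation_lifts_commute:
  assumes "u \<in> translation_lifts scale L E" and "w \<in> translation_lifts scale L E"
    and e: "e \<in> points E"
  shows "u (w e) = w (u e)"
proof -
  obtain x b where u: "\<And>e v d. e \<in> points E \<Longrightarrow> f e = orbit v d \<Longrightarrow> f (u e) = orbit (v + x) (b * d)"
    using translation_lifts_conjugate[OF assms(1)] by metis
  obtain y c where w: "\<And>e v d. e \<in> points E \<Longrightarrow> f e = orbit v d \<Longrightarrow> f (w e) = orbit (v + y) (c * d)"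
    using translation_lifts_conjugate[OF assms(2)] by metis
  have mem: "u e \<in> points E" "w e \<in> points E" if "e \<in> points E" for e
    using that assms translation_liftsE by metis+
  have bij: "bij_betw f (points E) (points F)"
    using iso by (simp add: bundle_iso_def biholomorphic_map_def)
  then obtain v d where "f e = orbit v d"
    using e bij_betw_apply[OF bij e] by (auto simp: points_flat)
  \<comment> \<open>Both sides equal \<open>orbit (v + x + y) (b * c * d)\<close> after reordering;
    injectivity of \<open>f\<close> then removes it.\<close>
  then have "f (u (w e)) = f (w (u e))"
    using u[OF mem(2)[OF e] w[OF e]] w[OF mem(1)[OF e] u[OF e]] by (simp add: ac_simps)
  then show ?thesis
    using bij mem e by (auto simp: bij_betw_def dest: inj_onD)
qed

lemma S_group_comm: "comm_group (S_group scale L E)"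
proof (rule group.group_comm_groupI[OF S_group_group])
  fix u w assume "u \<in> carrier (S_group scale L E)" "w \<in> carrier (S_group scale L E)"
  then have lifts: "u \<in> translation_lifts scale L E" "w \<in> translation_lifts scale L E"
    by (simp_all add: S_group_def)
  then have "u \<in> Bij (points E)" "w \<in> Bij (points E)"
    using translation_liftsE by metis+
  \<comment> \<open>Agreement on \<open>points E\<close> is equality of functions, because the
    product is \<open>compose\<close>, which is \<open>undefined\<close> elsewhere.\<close>
  then show "u \<otimes>\<^bsub>S_group scale L E\<^esub> w = w \<otimes>\<^bsub>S_group scale L E\<^esub> u"
    using translation_lifts_commute[OF lifts]
    by (simp add: S_group_def BijGroup_def compose_def restrict_def fun_eq_iff)
qed

end

theorem corollary1p6:
  fixes scale :: "complex \<Rightarrow> 'v::real_normed_vector \<Rightarrow> 'v"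
    and L :: "'v set"
    and E :: "('e, 'v \<times> complex, 'v set) line_bundle"
  assumes "complex_fd_space scale"
    and "torus_lattice scale L"
    and "holomorphic_line_bundle scale (torus L) E"
    and "in_Pic0 scale L E"
  shows "comm_group (S_group scale L E)"
proof -
  obtain \<alpha> f where "unitary_character L \<alpha>" "bundle_iso scale E (flat_bundle L \<alpha>) f"
    using assms(4) by (auto simp: in_Pic0_def)
  then interpret flat_torus_bundle scale L E \<alpha> f
    using assms(1-3)
    by (auto simp: flat_torus_bundle_def flat_torus_bundle_axioms_def torus_bundle_def
        torus_bundle_axioms_def flat_def flat_axioms_def)
  show ?thesis
    by (rule S_group_comm)
qed

end
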